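(* Let $p\ge2$ be an integer. There is a constant $C_p>0$ depending only on $p$ such that the following holds. Let $\mathcal X\subseteq\mathbb R^d$ be a nonempty closed bounded convex set with diameter $D=\max_{x,y\in\mathcal X}\|x-y\|$. Let $F:\mathcal X\to\mathbb R^d$ be a continuous operator that satisfies the Minty condition, i.e. there exists $x^*\in\mathcal X$ with $\langle F(x),x-x^*\rangle\ge0$ for all $x\in\mathcal X$, and is $(p-1)$-th-order $L_{p-1}$-smooth, i.e. $\|\nabla^{p-1}F(x)-\nabla^{p-1}F(y)\|_{\mathrm{op}}\le L_{p-1}\|x-y\|$ for all $x,y\in\mathcal X$. Let $G_i(v)$ ($1\le i\le p-1$, $v\in\mathcal X$) be inexact $i$-th derivatives of $F$ satisfying, with constants $\delta_i\ge0$, $$\left\|(\nabla^iF(v)-G_i(v))[x-v]^{i-1}\right\|\le\delta_i\|x-v\|^{i-1}\quad\text{for all }x,v\in\mathcal X.$$ Then after $T\ge1$ iterations of the algorithm VIHI with parameters $\eta_i=5p$ for all $i$, the output $\hat x_T=x_{k_T}$, where $k_T\in\arg\min_{1\le k\le T}\|x_k-v_k\|$ (option $\mathsf{opt}=2$), satisfies $$\sup_{x\in\mathcal X}\langle F(\hat x_T),\hat x_T-x\rangle\le C_p\left(\frac{L_{p-1}D^{p+1}}{T^{\frac p2}}+\sum_{i=1}^{p-1}\frac{\delta_iD^{i+1}}{T^{\frac i2}}\right).$$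
   Context: $\|\cdot\|$ is the Euclidean norm, $\|\cdot\|_{\mathrm{op}}$ the operator norm of multilinear maps. $\nabla^iF(v)$ is the $i$-th derivative, viewed as an $i$-linear map $(\mathbb R^d)^i\to\mathbb R^d$; $G_i(v)$ is an $i$-linear map of the same type. $A[h]^i$ means inserting $h$ in all $i$ arguments; $A[h]^{i-1}$ means inserting $h$ in $i-1$ arguments, leaving a linear map $\mathbb R^d\to\mathbb R^d$ whose operator norm is taken. Inexact model: $\Psi_{p,v}(x)=F(v)+\sum_{i=1}^{p-1}\frac1{i!}G_i(v)[x-v]^i$ and $$\Omega_{p,v}(x)=\Psi_{p,v}(x)+\sum_{i=1}^{p-1}\frac{\eta_i\delta_i}{i!}\|x-v\|^{i-1}(x-v)+\frac{5L_{p-1}}{(p-1)!}\|x-v\|^{p-1}(x-v).$$ Algorithm VIHI: given $x_0\in\mathcal X$, set $s_0=0\in\mathbb R^d$ and for $k=0,1,2,\dots$: (1) $v_{k+1}=\arg\max_{v\in\mathcal X}\{\langle s_k,v-x_0\rangle-\frac12\|v-x_0\|^2\}$; (2) $x_{k+1}\in\mathcal X$ is any point with $\sup_{x\in\mathcal X}\langle\Omega_{p,v_{k+1}}(x_{k+1}),x_{k+1}-x\rangle\le\frac{L_{p-1}}{p!}\|x_{k+1}-v_{k+1}\|^{p+1}+\sum_{i=1}^{p-1}\frac{\delta_i}{i!}\|x_{k+1}-v_{k+1}\|^{i+1}$; (3) $\lambda_{k+1}$ is any number with $\frac1{4(5p-2)}\le\lambda_{k+1}\left(\frac{L_{p-1}}{p!}\|x_{k+1}-v_{k+1}\|^{p-1}+\sum_{i=1}^{p-1}\frac{\delta_i}{i!}\|x_{k+1}-v_{k+1}\|^{i-1}\right)\le\frac1{2(5p+1)}$;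 (4) $s_{k+1}=s_k-\lambda_{k+1}F(x_{k+1})$. The iterates are assumed to be generated by this scheme (i.e. points $x_{k+1}$ satisfying (2) are available). *)

theory Defs
  imports "HOL-Analysis.Analysis"
begin

(* The constant of the theorem depends on p but not on the dimension d, so d has to be quantified
   inside the statement and cannot be (the cardinality of) a type.  We therefore realise all the
   spaces R^d inside one real inner product space, that of the finitely supported real sequences:
   R^d is the subspace Rn d of the sequences vanishing from index d on.  Its inner product and
   norm are the usual Euclidean ones (lemmas inner_Rn and norm_Rn), and its elements are exactly
   the d-tuples of reals (lemma Rn_tuple). *)

typedef fseq = "{f :: nat \<Rightarrow> real. finite {i. f i \<noteq> 0}}"
  morphisms coord Fseq
  by (rule exI[of _ "\<lambda>_. 0"]) simp

setup_lifting type_definition_fseq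

lemma finite_support: "finite {i. coord x i \<noteq> 0}"
  using coord[of x] by simp

lemma fseq_eqI: "(\<And>i. coord x i = coord y i) \<Longrightarrow> x = y"
  using coord_inject by blast

instantiation fseq :: real_vector
begin

lift_definition zero_fseq :: fseq is "\<lambda>_. 0" by simp
lift_definition plus_fseq :: "fseq \<Rightarrow> fseq \<Rightarrow> fseq" is "\<lambda>x y i. x i + y i"
proof -
  fix x y :: "nat \<Rightarrow> real"
  assume "finite {i. x i \<noteq> 0}" "finite {i. y i \<noteq> 0}"
  then show "finite {i. x i + y i \<noteq> 0}"
    by (rule_tac finite_subset[of _ "{i. x i \<noteq> 0} \<union> {i. y i \<noteq> 0}"]) auto
qed
lift_definition uminus_fseq :: "fseq \<Rightarrow> fseq" is "\<lambda>x i. - x i" by simp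
lift_definition minus_fseq :: "fseq \<Rightarrow> fseq \<Rightarrow> fseq" is "\<lambda>x y i. x i - y i"
proof -
  fix x y :: "nat \<Rightarrow> real"
  assume "finite {i. x i \<noteq> 0}" "finite {i. y i \<noteq> 0}"
  then show "finite {i. x i - y i \<noteq> 0}"
    by (rule_tac finite_subset[of _ "{i. x i \<noteq> 0} \<union> {i. y i \<noteq> 0}"]) auto
qed
lift_definition scaleR_fseq :: "real \<Rightarrow> fseq \<Rightarrow> fseq" is "\<lambda>c x i. c * x i"
  by (rule finite_subset) auto

instance
  by standard (transfer; simp add: algebra_simps fun_eq_iff)+

end

lemma coord_simps [simp]:
  "coord 0 i = 0" "coord (x + y) i = coord x i + coord y i" "coord (- x) i = - coord x i"
  "coord (x - y) i = coord x i - coord y i" "coord (c *\<^sub>R x) i = c * coord x i"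
  by (transfer; simp)+

instantiation fseq :: real_normed_vector
begin

definition norm_fseq :: "fseq \<Rightarrow> real"
  where "norm x = L2_set (coord x) {i. coord x i \<noteq> 0}"
definition sgn_fseq :: "fseq \<Rightarrow> fseq"
  where "sgn (x :: fseq) = x /\<^sub>R norm x"
definition dist_fseq :: "fseq \<Rightarrow> fseq \<Rightarrow> real"
  where "dist (x :: fseq) y = norm (x - y)"
definition uniformity_fseq :: "(fseq \<times> fseq) filter"
  where "uniformity = (INF e\<in>{0<..}. principal {(x :: fseq, y). dist x y < e})"
definition open_fseq :: "fseq set \<Rightarrow> bool"
  where "open (U :: fseq set) \<longleftrightarrow> (\<forall>x\<in>U. \<forall>\<^sub>F (x', y) in uniformity. x' = x \<longrightarrow> y \<in> U)"

lemma norm_fseq_superset: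
  assumes "finite A" "{i. coord x i \<noteq> 0} \<subseteq> A"
  shows "norm x = L2_set (coord x) A"
  unfolding norm_fseq_def L2_set_def using assms
  by (intro arg_cong[of _ _ sqrt] sum.mono_neutral_left) auto

instance
proof
  fix x y :: fseq and c :: real
  let ?A = "{i. coord x i \<noteq> 0} \<union> {i. coord y i \<noteq> 0}"
  have fin: "finite ?A" using finite_support by simp
  have "norm x = 0 \<longleftrightarrow> (\<forall>i\<in>{i. coord x i \<noteq> 0}. coord x i = 0)"
    unfolding norm_fseq_def by (rule L2_set_eq_0_iff) (rule finite_support)
  then show "norm x = 0 \<longleftrightarrow> x = 0"
    by (auto intro: fseq_eqI)
  have nx: "norm x = L2_set (coord x) ?A" and ny: "norm y = L2_set (coord y) ?A"
    and nxy: "norm (x + y) = L2_set (coord (x + y)) ?A"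
    and nc: "norm (c *\<^sub>R x) = L2_set (coord (c *\<^sub>R x)) ?A"
    by (rule norm_fseq_superset[OF fin]; force)+
  show "norm (x + y) \<le> norm x + norm y"
    using L2_set_triangle_ineq[of "coord x" "coord y" ?A] by (simp add: nx ny nxy L2_set_def)
  show "norm (c *\<^sub>R x) = \<bar>c\<bar> * norm x"
    by (simp add: nx nc L2_set_def power_mult_distrib sum_distrib_left[symmetric] real_sqrt_mult)
qed (rule sgn_fseq_def dist_fseq_def uniformity_fseq_def open_fseq_def)+

end

instantiation fseq :: real_inner
begin

definition inner_fseq :: "fseq \<Rightarrow> fseq \<Rightarrow> real"
  where "inner x y = (\<Sum>i | coord x i \<noteq> 0. coord x i * coord y i)"

lemma inner_fseq_superset:
  assumes "finite A" "{i. coord x i \<noteq> 0} \<subseteq> A"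
  shows "inner x y = (\<Sum>i\<in>A. coord x i * coord y i)"
  unfolding inner_fseq_def using assms by (intro sum.mono_neutral_left) auto

instance
proof
  fix x y z :: fseq and c :: real
  let ?A = "{i. coord x i \<noteq> 0} \<union> {i. coord y i \<noteq> 0}"
  have fin: "finite ?A" using finite_support by simp
  have x: "inner x w = (\<Sum>i\<in>?A. coord x i * coord w i)" for w
    by (rule inner_fseq_superset[OF fin]) auto
  have y: "inner y w = (\<Sum>i\<in>?A. coord y i * coord w i)" for w
    by (rule inner_fseq_superset[OF fin]) auto
  have xy: "inner (x + y) w = (\<Sum>i\<in>?A. coord (x + y) i * coord w i)" for w
    by (rule inner_fseq_superset[OF fin]) auto
  have cx: "inner (c *\<^sub>R x) w = (\<Sum>i\<in>?A. coord (c *\<^sub>R x) i * coord w i)" for w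
    by (rule inner_fseq_superset[OF fin]) auto
  show "inner x y = inner y x" by (simp add: x y mult.commute)
  show "inner (x + y) z = inner x z + inner y z"
    by (simp add: x y xy sum.distrib distrib_right)
  show "inner (c *\<^sub>R x) y = c * inner x y"
    by (simp add: x cx sum_distrib_left mult.assoc)
  show "0 \<le> inner x x" by (simp add: x sum_nonneg)
  show "inner x x = 0 \<longleftrightarrow> x = 0"
  proof
    assume "inner x x = 0"
    then have "\<forall>i\<in>{i. coord x i \<noteq> 0}. coord x i * coord x i = 0"
      unfolding inner_fseq_def
      by (subst (asm) sum_nonneg_eq_0_iff) (auto simp: finite_support)
    then show "x = 0" by (intro fseq_eqI) auto
  qed (simp add: inner_fseq_def)
  show "norm x = sqrt (inner x x)"
    by (simp add: norm_fseq_def inner_fseq_def L2_set_def power2_eq_square)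
qed

end

definition Rn :: "nat \<Rightarrow> fseq set"
  where "Rn d = {x. \<forall>i\<ge>d. coord x i = 0}"

lemma inner_Rn:
  assumes "x \<in> Rn d"
  shows "inner x y = (\<Sum>i<d. coord x i * coord y i)"
  using assms by (intro inner_fseq_superset) (auto simp: Rn_def not_le[symmetric])

lemma norm_Rn: "x \<in> Rn d \<Longrightarrow> norm x = sqrt (\<Sum>i<d. (coord x i)\<^sup>2)"
  by (simp add: norm_eq_sqrt_inner inner_Rn power2_eq_square)

lemma Rn_tuple: "\<exists>!x. x \<in> Rn d \<and> (\<forall>i<d. coord x i = f i)"
proof (rule ex_ex1I)
  have "finite {i. (if i < d then f i else 0) \<noteq> 0}"
    by (rule finite_subset[of _ "{..<d}"]) auto
  then have "coord (Fseq (\<lambda>i. if i < d then f i else 0)) = (\<lambda>i. if i < d then f i else 0)"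
    by (simp add: Fseq_inverse)
  then show "\<exists>x. x \<in> Rn d \<and> (\<forall>i<d. coord x i = f i)"
    by (intro exI[of _ "Fseq (\<lambda>i. if i < d then f i else 0)"]) (simp add: Rn_def)
next
  fix x y
  assume "x \<in> Rn d \<and> (\<forall>i<d. coord x i = f i)" "y \<in> Rn d \<and> (\<forall>i<d. coord y i = f i)"
  then show "x = y" by (intro fseq_eqI) (metis (mono_tags) Rn_def mem_Collect_eq not_le)
qed

lemma subspace_Rn: "subspace (Rn d)"
  by (auto simp: subspace_def Rn_def)

(* An i-linear map (R^d)^i -> R^d is represented by a function on lists, of which only the
   values on lists of length i with entries in Rn d are relevant. *)

definition tuples :: "nat \<Rightarrow> nat \<Rightarrow> fseq list set"
  where "tuples d i = {hs. length hs = i \<and> set hs \<subseteq> Rn d}"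

definition multilinear :: "nat \<Rightarrow> nat \<Rightarrow> (fseq list \<Rightarrow> fseq) \<Rightarrow> bool"
  where "multilinear d i A \<longleftrightarrow>
    (\<forall>hs\<in>tuples d i. A hs \<in> Rn d) \<and>
    (\<forall>xs a ys. xs @ a # ys \<in> tuples d i \<longrightarrow>
      (\<forall>b\<in>Rn d. A (xs @ (a + b) # ys) = A (xs @ a # ys) + A (xs @ b # ys)) \<and>
      (\<forall>c. A (xs @ (c *\<^sub>R a) # ys) = c *\<^sub>R A (xs @ a # ys)))"

definition opnorm :: "nat \<Rightarrow> nat \<Rightarrow> (fseq list \<Rightarrow> fseq) \<Rightarrow> real"
  where "opnorm d i A = (SUP hs\<in>{hs \<in> tuples d i. \<forall>h\<in>set hs. norm h \<le> 1}. norm (A hs))"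

(* A[h]^m, leaving the last slots open; A[h]^i itself, for an i-linear A, is A (replicate i h). *)
definition insert_pow :: "(fseq list \<Rightarrow> fseq) \<Rightarrow> nat \<Rightarrow> fseq \<Rightarrow> fseq list \<Rightarrow> fseq"
  where "insert_pow A m h = (\<lambda>us. A (replicate m h @ us))"

(* DF i v is the i-th derivative of F at v, for i \<le> n and v in X.  Derivatives are taken within X
   (the domain of F), and DF (i+1) is the Frechet derivative of DF i, the direction of the last
   differentiation being the first argument.  If X has nonempty interior in R^d then DF is
   determined by F; otherwise any such family is admitted.  The map f' is needed since
   has_derivative refers to the ambient space: f' is a linear extension from Rn d. *)
definition derivatives ::
  "nat \<Rightarrow> fseq set \<Rightarrow> nat \<Rightarrow> (fseq \<Rightarrow> fseq) \<Rightarrow> (nat \<Rightarrow> fseq \<Rightarrow> fseq list \<Rightarrow> fseq) \<Rightarrow> bool"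
  where "derivatives d X n F DF \<longleftrightarrow>
    (\<forall>v\<in>X. DF 0 v [] = F v) \<and>
    (\<forall>i\<le>n. \<forall>v\<in>X. multilinear d i (DF i v)) \<and>
    (\<forall>i<n. \<forall>v\<in>X. \<forall>hs\<in>tuples d i.
      \<exists>f'. ((\<lambda>y. DF i y hs) has_derivative f') (at v within X) \<and>
           (\<forall>u\<in>Rn d. f' u = DF (Suc i) v (u # hs)))"

definition minty :: "fseq set \<Rightarrow> (fseq \<Rightarrow> fseq) \<Rightarrow> bool"
  where "minty X F \<longleftrightarrow> (\<exists>xs\<in>X. \<forall>x\<in>X. inner (F x) (x - xs) \<ge> 0)"

definition Psi :: "nat \<Rightarrow> (fseq \<Rightarrow> fseq) \<Rightarrow> (nat \<Rightarrow> fseq \<Rightarrow> fseq list \<Rightarrow> fseq) \<Rightarrow> fseq \<Rightarrow> fseq \<Rightarrow> fseq"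
  where "Psi p F G v x = F v + (\<Sum>i=1..p-1. (1 / fact i) *\<^sub>R G i v (replicate i (x - v)))"

definition Omega :: "nat \<Rightarrow> (fseq \<Rightarrow> fseq) \<Rightarrow> (nat \<Rightarrow> fseq \<Rightarrow> fseq list \<Rightarrow> fseq) \<Rightarrow>
    (nat \<Rightarrow> real) \<Rightarrow> (nat \<Rightarrow> real) \<Rightarrow> real \<Rightarrow> fseq \<Rightarrow> fseq \<Rightarrow> fseq"
  where "Omega p F G \<eta> \<delta> L v x = Psi p F G v x
    + (\<Sum>i=1..p-1. (\<eta> i * \<delta> i / fact i * norm (x - v) ^ (i - 1)) *\<^sub>R (x - v))
    + (5 * L / fact (p - 1) * norm (x - v) ^ (p - 1)) *\<^sub>R (x - v)"

(* x, v, s, lam are the sequences produced by the first T iterations of the scheme; only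
   x 0, ..., x T, s 0, ..., s T, v 1, ..., v T and lam 1, ..., lam T are constrained. *)
definition VIHI :: "nat \<Rightarrow> fseq set \<Rightarrow> (fseq \<Rightarrow> fseq) \<Rightarrow> (nat \<Rightarrow> fseq \<Rightarrow> fseq list \<Rightarrow> fseq) \<Rightarrow>
    (nat \<Rightarrow> real) \<Rightarrow> (nat \<Rightarrow> real) \<Rightarrow> real \<Rightarrow> nat \<Rightarrow>
    (nat \<Rightarrow> fseq) \<Rightarrow> (nat \<Rightarrow> fseq) \<Rightarrow> (nat \<Rightarrow> fseq) \<Rightarrow> (nat \<Rightarrow> real) \<Rightarrow> bool"
  where "VIHI p X F G \<eta> \<delta> L T x v s lam \<longleftrightarrow>
    x 0 \<in> X \<and> s 0 = 0 \<and>
    (\<forall>k<T.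
      is_arg_max (\<lambda>w. inner (s k) (w - x 0) - 1/2 * (norm (w - x 0))\<^sup>2) (\<lambda>w. w \<in> X) (v (k+1)) \<and>
      x (k+1) \<in> X \<and>
      (SUP y\<in>X. inner (Omega p F G \<eta> \<delta> L (v (k+1)) (x (k+1))) (x (k+1) - y))
        \<le> L / fact p * norm (x (k+1) - v (k+1)) ^ (p + 1)
          + (\<Sum>i=1..p-1. \<delta> i / fact i * norm (x (k+1) - v (k+1)) ^ (i + 1)) \<and>
      1 / (4 * (5 * real p - 2))
        \<le> lam (k+1) * (L / fact p * norm (x (k+1) - v (k+1)) ^ (p - 1)
          + (\<Sum>i=1..p-1. \<delta> i / fact i * norm (x (k+1) - v (k+1)) ^ (i - 1))) \<and>
      lam (k+1) * (L / fact p * norm (x (k+1) - v (k+1)) ^ (p - 1)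
          + (\<Sum>i=1..p-1. \<delta> i / fact i * norm (x (k+1) - v (k+1)) ^ (i - 1)))
        \<le> 1 / (2 * (5 * real p + 1)) \<and>
      s (k+1) = s k - lam (k+1) *\<^sub>R F (x (k+1)))"

end

theory Submission
  imports Defs
begin

text \<open>
  Let \<open>r = \<parallel>x - v\<parallel>\<close> be the length of a step and
  \<open>e = L / p! r\<^bsup>p-1\<^esup> + \<Sum> \<delta>\<^sub>i / i! r\<^bsup>i-1\<^esup>\<close>. Taylor's formula and the bounds on the inexact derivatives
  give \<open>\<parallel>F x - \<Psi> x\<parallel> \<le> e r\<close> (\<open>Psi_error\<close>), and with \<open>\<eta>\<^sub>i = 5 p\<close> the regularised model is
  \<open>\<Omega> x = \<Psi> x + 5 p e (x - v)\<close> (\<open>Omega_eq_Psi\<close>).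

  The subproblem makes \<open>\<langle>\<Omega> x, x - w\<rangle>\<close> at most \<open>e r\<^sup>2\<close> for every \<open>w\<close> in \<open>X\<close>. Expanding
  \<open>\<langle>x - v, x - w\<rangle>\<close> by the law of cosines, the regularisation outweighs the model error and the
  tolerance, and since \<open>\<lambda> e\<close> lies between two constants of order \<open>1 / p\<close>, this gives
  \<open>\<lambda> \<langle>F x, x - w\<rangle> + r\<^sup>2 / 16 \<le> \<parallel>w - v\<parallel>\<^sup>2 / 2\<close> (\<open>one_step_progress\<close>). The right-hand side is exactly
  what the strong concavity of the \<open>v\<close>-update provides, so summing over the iterations telescopes to
  \<open>\<Sum> \<lambda> \<langle>F x, x - w\<rangle> + r\<^sup>2 / 16 \<le> \<parallel>w - x\<^sub>0\<parallel>\<^sup>2 / 2\<close> (\<open>dual_extrapolation_regret\<close>). For \<open>w\<close> the Minty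
  solution the inner products are nonnegative. Hence the shortest of the \<open>T\<close> steps satisfies
  \<open>r\<^sup>2 \<le> 8 D\<^sup>2 / T\<close>.

  Finally, by the same estimates, the gap of \<open>F\<close> at \<open>x\<close> is at most \<open>(5 p + 2) e r D\<close>
  (\<open>approximate_solution_gap\<close>). As \<open>e r = L / p! r\<^bsup>p\<^esup> + \<Sum> \<delta>\<^sub>i / i! r\<^bsup>i\<^esup>\<close>, inserting \<open>r \<le> 3 D / \<surd>T\<close> gives
  the claim with the constant \<open>(5 p + 2) 3\<^bsup>p\<^esup>\<close>.
\<close>

section \<open>Multilinear maps on Rn d and their operator norm\<close>

lemma Rn_closed:
  "0 \<in> Rn d" "x \<in> Rn d \<Longrightarrow> y \<in> Rn d \<Longrightarrow> x + y \<in> Rn d"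
  "x \<in> Rn d \<Longrightarrow> y \<in> Rn d \<Longrightarrow> x - y \<in> Rn d" "x \<in> Rn d \<Longrightarrow> c *\<^sub>R x \<in> Rn d"
  by (auto simp: Rn_def)

lemma Rn_basis:
  "\<exists>e. (\<forall>j<d. e j \<in> Rn d) \<and>
    (\<forall>h\<in>Rn d. h = (\<Sum>j<d. coord h j *\<^sub>R e j))"
proof -
  have "\<exists>e. e \<in> Rn d \<and> (\<forall>i<d. coord e i = (if i = j then 1 else 0))" for j :: nat
    using Rn_tuple[of d "\<lambda>i. if i = j then 1 else 0"] by (rule ex1_implies_ex)
  then have "\<exists>e. \<forall>j. e j \<in> Rn d \<and> (\<forall>i<d. coord (e j) i = (if i = j then 1 else 0))"
    by (intro choice) simp
  then obtain e where e: "\<And>j. e j \<in> Rn d"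
    "\<And>i j. i < d \<Longrightarrow> coord (e j) i = (if i = j then 1 else 0)"
    by auto
  have "h = (\<Sum>j<d. coord h j *\<^sub>R e j)" if h: "h \<in> Rn d" for h
  proof (rule fseq_eqI)
    fix i
    have *: "coord (\<Sum>j<m. c j *\<^sub>R e j) i = (\<Sum>j<m. c j * coord (e j) i)" for c and m :: nat
      by (induction m) auto
    show "coord h i = coord (\<Sum>j<d. coord h j *\<^sub>R e j) i"
    proof (cases "i < d")
      case True
      then have "(\<Sum>j<d. coord h j * coord (e j) i) = (\<Sum>j<d. if j = i then coord h i else 0)"
        by (intro sum.cong) (auto simp: e)
      then show ?thesis using True by (simp add: *)
    next
      case False
      then show ?thesis using h e(1) by (auto simp: * Rn_def)
    qed
  qed
  then show ?thesis using e(1) by (intro exI[of _ e] conjI allI impI ballI) simp_all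
qed

lemma abs_coord_le_norm: "h \<in> Rn d \<Longrightarrow> \<bar>coord h j\<bar> \<le> norm h"
proof (cases "j < d")
  case True
  assume h: "h \<in> Rn d"
  have "(coord h j)\<^sup>2 \<le> (\<Sum>i<d. (coord h i)\<^sup>2)"
    using True by (intro member_le_sum) auto
  then have "sqrt ((coord h j)\<^sup>2) \<le> sqrt (\<Sum>i<d. (coord h i)\<^sup>2)"
    by (rule real_sqrt_le_mono)
  then show ?thesis by (simp only: norm_Rn[OF h] real_sqrt_abs)
qed (simp add: Rn_def)

lemma multilinear_closed: "multilinear d i A \<Longrightarrow> hs \<in> tuples d i \<Longrightarrow> A hs \<in> Rn d"
  by (simp add: multilinear_def)

lemma multilinear_add:
  "multilinear d i A \<Longrightarrow> xs @ a # ys \<in> tuples d i \<Longrightarrow> b \<in> Rn d \<Longrightarrow>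
    A (xs @ (a + b) # ys) = A (xs @ a # ys) + A (xs @ b # ys)"
  by (simp add: multilinear_def)

lemma multilinear_scale:
  "multilinear d i A \<Longrightarrow> xs @ a # ys \<in> tuples d i \<Longrightarrow>
    A (xs @ (c *\<^sub>R a) # ys) = c *\<^sub>R A (xs @ a # ys)"
  by (simp add: multilinear_def)

lemma multilinear_diff:
  assumes "multilinear d i A" "multilinear d i B"
  shows "multilinear d i (\<lambda>hs. A hs - B hs)"
  using assms unfolding multilinear_def
  by (auto simp: algebra_simps intro: Rn_closed)

lemma multilinear_insert_pow:
  assumes A: "multilinear d (m + k) A" and h: "h \<in> Rn d"
  shows "multilinear d k (insert_pow A m h)"
proof -
  have ins: "replicate m h @ us \<in> tuples d (m + k)" if "us \<in> tuples d k" for us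
    using that h by (auto simp: tuples_def)
  show ?thesis
    unfolding multilinear_def insert_pow_def
  proof (intro conjI ballI allI impI)
    fix hs assume "hs \<in> tuples d k"
    then show "A (replicate m h @ hs) \<in> Rn d"
      by (intro multilinear_closed[OF A] ins)
  next
    fix xs a ys b assume "xs @ a # ys \<in> tuples d k" "b \<in> Rn d"
    then show "A (replicate m h @ xs @ (a + b) # ys)
        = A (replicate m h @ xs @ a # ys) + A (replicate m h @ xs @ b # ys)"
      using multilinear_add[OF A, of "replicate m h @ xs" a ys b] ins by simp
  next
    fix xs a ys c assume "xs @ a # ys \<in> tuples d k"
    then show "A (replicate m h @ xs @ (c *\<^sub>R a) # ys) = c *\<^sub>R A (replicate m h @ xs @ a # ys)"
      using multilinear_scale[OF A, of "replicate m h @ xs" a ys c] ins by simp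
  qed
qed

lemma multilinear_head_sum:
  fixes m :: nat
  assumes A: "multilinear d (Suc i) A" and hs: "hs \<in> tuples d i"
    and e: "\<And>j. j < m \<Longrightarrow> e j \<in> Rn d"
  shows "A ((\<Sum>j<m. c j *\<^sub>R e j) # hs) = (\<Sum>j<m. c j *\<^sub>R A (e j # hs))"
  using e
proof (induction m)
  case 0
  have "(0::fseq) # hs \<in> tuples d (Suc i)" using hs by (auto simp: tuples_def Rn_closed)
  then show ?case using multilinear_scale[OF A, of "[]" 0 hs 0] by simp
next
  case (Suc m)
  have "(\<Sum>j<m. c j *\<^sub>R e j) \<in> Rn d"
    using Suc.prems by (auto intro!: subspace_sum[OF subspace_Rn] Rn_closed)
  moreover have em: "e m \<in> Rn d" using Suc.prems by simp
  ultimately show ?case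
    using multilinear_add[OF A, of "[]" "\<Sum>j<m. c j *\<^sub>R e j" hs "c m *\<^sub>R e m"]
      multilinear_scale[OF A, of "[]" "e m" hs "c m"] hs Suc
    by (auto simp: tuples_def Rn_closed)
qed

text \<open>A multilinear map in finite dimension is bounded on the unit ball; this is what makes the
  supremum in \<^const>\<open>opnorm\<close> a genuine one. Expanding the first argument in the standard basis
  reduces the number of arguments.\<close>

lemma multilinear_bounded:
  assumes "multilinear d i A"
  shows "\<exists>B. \<forall>hs\<in>tuples d i. (\<forall>h\<in>set hs. norm h \<le> 1) \<longrightarrow> norm (A hs) \<le> B"
  using assms
proof (induction i arbitrary: A)
  case 0
  then show ?case by (auto simp: tuples_def)
next
  case (Suc i)
  obtain e where e: "\<And>j. j < d \<Longrightarrow> e j \<in> Rn d" "\<And>h. h \<in> Rn d \<Longrightarrow> (\<Sum>j<d. coord h j *\<^sub>R e j) = h"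
    using Rn_basis[of d] by metis
  have "\<exists>B. \<forall>hs\<in>tuples d i. (\<forall>h\<in>set hs. norm h \<le> 1) \<longrightarrow> norm (A (e j # hs)) \<le> B"
    if "j < d" for j
    using Suc.IH[OF multilinear_insert_pow[of d 1 i A "e j"]] Suc.prems e(1)[OF that]
    by (auto simp: insert_pow_def)
  then obtain B where B: "\<And>j hs. j < d \<Longrightarrow> hs \<in> tuples d i \<Longrightarrow> (\<forall>h\<in>set hs. norm h \<le> 1) \<Longrightarrow>
      norm (A (e j # hs)) \<le> B j"
    by metis
  show ?case
  proof (intro exI[of _ "\<Sum>j<d. B j"] ballI impI)
    fix hs assume hs: "hs \<in> tuples d (Suc i)" "\<forall>h\<in>set hs. norm h \<le> 1"
    then obtain h hs' where hs': "hs = h # hs'" "h \<in> Rn d" "hs' \<in> tuples d i"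
      by (cases hs) (auto simp: tuples_def)
    have "A hs = (\<Sum>j<d. coord h j *\<^sub>R A (e j # hs'))"
      using multilinear_head_sum[OF Suc.prems hs'(3), of d e "coord h"] e(1)
      by (simp add: hs'(1) e(2)[OF hs'(2)])
    also have "norm \<dots> \<le> (\<Sum>j<d. B j)"
    proof (rule sum_norm_le)
      fix j assume j: "j \<in> {..<d}"
      have "\<bar>coord h j\<bar> \<le> 1"
        using abs_coord_le_norm[OF hs'(2), of j] hs(2) hs'(1) by auto
      then have "norm (coord h j *\<^sub>R A (e j # hs')) \<le> 1 * norm (A (e j # hs'))"
        by (simp add: mult_left_le_one_le)
      also have "\<dots> \<le> B j" using B[of j hs'] j hs hs' by auto
      finally show "norm (coord h j *\<^sub>R A (e j # hs')) \<le> B j" .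
    qed
    finally show "norm (A hs) \<le> (\<Sum>j<d. B j)" .
  qed
qed

lemma norm_le_opnorm:
  assumes "multilinear d i A" "hs \<in> tuples d i" "\<forall>h\<in>set hs. norm h \<le> 1"
  shows "norm (A hs) \<le> opnorm d i A"
proof -
  obtain B where B: "\<forall>hs\<in>tuples d i. (\<forall>h\<in>set hs. norm h \<le> 1) \<longrightarrow> norm (A hs) \<le> B"
    using multilinear_bounded[OF assms(1)] by (rule exE)
  show ?thesis
    unfolding opnorm_def
  proof (rule cSUP_upper[where f = "\<lambda>hs. norm (A hs)" and x = hs])
    show "bdd_above ((\<lambda>hs. norm (A hs)) ` {hs \<in> tuples d i. \<forall>h\<in>set hs. norm h \<le> 1})"
      by (rule bdd_aboveI2[where M = B]) (use B in simp)
    show "hs \<in> {hs \<in> tuples d i. \<forall>h\<in>set hs. norm h \<le> 1}"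
      using assms by simp
  qed
qed

lemma opnorm_nonneg:
  assumes "multilinear d i A"
  shows "0 \<le> opnorm d i A"
proof -
  have "replicate i 0 \<in> tuples d i" by (auto simp: tuples_def Rn_closed)
  then have "norm (A (replicate i 0)) \<le> opnorm d i A"
    using assms by (intro norm_le_opnorm) auto
  then show ?thesis using norm_ge_zero order_trans by blast
qed

lemma multilinear_diagonal_scale:
  assumes A: "multilinear d i A" and u: "u \<in> Rn d"
  shows "A (replicate i (c *\<^sub>R u)) = c ^ i *\<^sub>R A (replicate i u)"
proof -
  \<comment> \<open>The scalar is pulled out of one argument at a time, from the left.\<close>
  have "A (replicate k (c *\<^sub>R u) @ replicate (i - k) u) = c ^ k *\<^sub>R A (replicate i u)"
    if "k \<le> i" for k
    using that
  proof (induction k)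
    case (Suc k)
    define m where "m = i - Suc k"
    have i: "i - k = Suc m" using Suc.prems by (simp add: m_def)
    have "A (replicate (Suc k) (c *\<^sub>R u) @ replicate (i - Suc k) u)
        = A (replicate k (c *\<^sub>R u) @ (c *\<^sub>R u) # replicate m u)"
      by (simp add: m_def replicate_app_Cons_same)
    also have "\<dots> = c *\<^sub>R A (replicate k (c *\<^sub>R u) @ u # replicate m u)"
      using u Suc.prems by (intro multilinear_scale[OF A]) (auto simp: tuples_def m_def Rn_closed)
    also have "u # replicate m u = replicate (i - k) u" by (simp add: i)
    also have "A (replicate k (c *\<^sub>R u) @ replicate (i - k) u) = c ^ k *\<^sub>R A (replicate i u)"
      using Suc by simp
    finally show ?case by simp
  qed simp
  from this[of i] show ?thesis by simp
qed

text \<open>The Taylor expansion and the model involve values of multilinear maps on the diagonal only, and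
  this is how the hypotheses on \<^const>\<open>opnorm\<close> bound them.\<close>

lemma norm_diagonal_le_opnorm:
  assumes A: "multilinear d i A" and h: "h \<in> Rn d"
  shows "norm (A (replicate i h)) \<le> opnorm d i A * norm h ^ i"
proof -
  \<comment> \<open>For \<open>h = 0\<close> the normalised vector is \<open>0\<close>, and the identity still holds.\<close>
  define u where "u = inverse (norm h) *\<^sub>R h"
  have u: "u \<in> Rn d" "norm u \<le> 1" "norm h *\<^sub>R u = h"
    using h by (cases "h = 0"; simp add: u_def Rn_closed)+
  have "norm (A (replicate i h)) = norm h ^ i * norm (A (replicate i u))"
    using multilinear_diagonal_scale[OF A u(1), of "norm h"] by (simp add: u(3))
  also have "\<dots> \<le> norm h ^ i * opnorm d i A"
    using u by (intro mult_left_mono norm_le_opnorm[OF A]) (auto simp: tuples_def)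
  finally show ?thesis by (simp add: mult.commute)
qed

section \<open>Taylor's formula along a segment\<close>

text \<open>By induction on \<open>n\<close>: the difference between \<open>f 0\<close> and its Taylor polynomial vanishes at \<open>0\<close>, and
  its derivative is the same difference for the shifted sequence \<open>f 1, f 2, \<dots>\<close>, so the mean value
  inequality integrates the bound once. That inequality holds in every normed space, in particular
  in the incomplete one of finitely supported sequences.\<close>

lemma taylor_Lipschitz:
  fixes f :: "nat \<Rightarrow> real \<Rightarrow> 'a::real_normed_vector"
  assumes "\<And>i t. i < n \<Longrightarrow> t \<in> {0..1} \<Longrightarrow> (f i has_vector_derivative f (Suc i) t) (at t within {0..1})"
    and "\<And>t. t \<in> {0..1} \<Longrightarrow> norm (f n t - f n 0) \<le> M * t"
    and "t \<in> {0..1}"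
  shows "norm (f 0 t - (\<Sum>i\<le>n. (t ^ i / fact i) *\<^sub>R f i 0)) \<le> M * t ^ Suc n / fact (Suc n)"
  using assms
proof (induction n arbitrary: f t)
  case 0
  then show ?case by auto
next
  case (Suc n)
  define P where "P = (\<lambda>t. \<Sum>i\<le>Suc n. (t ^ i / fact i) *\<^sub>R f i 0)"
  define Q where "Q = (\<lambda>t. \<Sum>i\<le>n. (t ^ i / fact i) *\<^sub>R f (Suc i) 0)"
  have P0: "P 0 = f 0 0"
    unfolding P_def by (subst sum.atMost_Suc_shift) simp
  have monomial': "((\<lambda>t::real. t ^ Suc i / fact (Suc i)) has_real_derivative s ^ i / fact i) (at s within A)"
    for s A i
  proof -
    have "((\<lambda>t. t ^ Suc i) has_real_derivative real (Suc i) * s ^ i) (at s within A)"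
      using DERIV_pow[of "Suc i" s A] by (simp only: diff_Suc_Suc diff_zero One_nat_def)
    then have "((\<lambda>t. t ^ Suc i / fact (Suc i)) has_real_derivative
        (real (Suc i) * s ^ i) / fact (Suc i)) (at s within A)"
      by (rule DERIV_cdivide)
    also have "(real (Suc i) * s ^ i) / fact (Suc i) = s ^ i / fact i"
      by (simp add: divide_simps)
    finally show ?thesis .
  qed
  have P': "(P has_vector_derivative Q s) (at s within A)" for s A
  proof -
    have *: "((\<lambda>t. (t ^ Suc i / fact (Suc i)) *\<^sub>R f (Suc i) 0) has_vector_derivative
      (s ^ i / fact i) *\<^sub>R f (Suc i) 0) (at s within A)" for i
      using has_vector_derivative_scaleR[OF monomial' has_vector_derivative_const[of "f (Suc i) 0"]]
      by simp
    have "P = (\<lambda>t. f 0 0 + (\<Sum>i\<le>n. (t ^ Suc i / fact (Suc i)) *\<^sub>R f (Suc i) 0))"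
      unfolding P_def by (rule ext, subst sum.atMost_Suc_shift) simp
    then show ?thesis
      using has_vector_derivative_add[OF has_vector_derivative_const has_vector_derivative_sum, OF *]
      by (simp add: Q_def del: power_Suc)
  qed
  have f': "((\<lambda>s. f 0 s - P s) has_vector_derivative f 1 s - Q s) (at s within {0..1})"
    if "s \<in> {0..1}" for s
    using Suc.prems(1)[of 0 s] that by (auto intro!: has_vector_derivative_diff P')
  have bound: "norm (f 1 s - Q s) \<le> M * s ^ Suc n / fact (Suc n)" if "s \<in> {0..1}" for s
    using Suc.IH[of "\<lambda>i. f (Suc i)" s] Suc.prems(1,2) that by (simp add: Q_def)
  show ?case
  proof (cases "t = 0")
    case True
    then show ?thesis using P0 by (simp add: P_def)
  next
    case False
    then have t: "0 < t" "t \<le> 1" using Suc.prems by auto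
    have "norm ((f 0 t - P t) - (f 0 0 - P 0))
        \<le> M * t ^ Suc (Suc n) / fact (Suc (Suc n)) - M * 0 ^ Suc (Suc n) / fact (Suc (Suc n))"
    proof (rule differentiable_bound_general[OF t(1)])
      have "continuous_on {0..1} (\<lambda>s. f 0 s - P s)"
        unfolding continuous_on_eq_continuous_within
        by (rule ballI) (rule has_vector_derivative_continuous[OF f'])
      then show "continuous_on {0..t} (\<lambda>s. f 0 s - P s)"
        by (rule continuous_on_subset) (use t in auto)
      show "continuous_on {0..t} (\<lambda>s. M * s ^ Suc (Suc n) / fact (Suc (Suc n)))"
        by (intro continuous_intros) auto
    next
      fix s assume s: "0 < s" "s < t"
      then have s1: "s \<in> {0..1}" "s \<in> {0<..<1}" using t by auto
      show "((\<lambda>s. f 0 s - P s) has_vector_derivative f 1 s - Q s) (at s)"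
        using f'[OF s1(1)] s1(2) by (simp only: at_within_Icc_at greaterThanLessThan_iff)
      show "((\<lambda>s. M * s ^ Suc (Suc n) / fact (Suc (Suc n))) has_vector_derivative
          M * s ^ Suc n / fact (Suc n)) (at s)"
        using DERIV_cmult[OF monomial'[of "Suc n" s UNIV], of M]
        by (simp only: has_real_derivative_iff_has_vector_derivative times_divide_eq_right)
      show "norm (f 1 s - Q s) \<le> M * s ^ Suc n / fact (Suc n)"
        by (rule bound[OF s1(1)])
    qed
    then show ?thesis using P0 by (simp add: P_def)
  qed
qed

lemma convex_segmentD:
  fixes X :: "'a::real_vector set"
  assumes "convex X" "w \<in> X" "y \<in> X" "t \<in> {0..1}"
  shows "w + t *\<^sub>R (y - w) \<in> X"
proof -
  have "w + t *\<^sub>R (y - w) = (1 - t) *\<^sub>R w + t *\<^sub>R y" by (simp add: algebra_simps)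
  also have "\<dots> \<in> X" by (rule convexD[OF assms(1-3)]) (use assms(4) in auto)
  finally show ?thesis .
qed

text \<open>All directions along the segment agree, so differentiating \<open>DF i\<close>, which prepends the new
  direction to the list of arguments, just lengthens a list of copies of \<open>y - w\<close>.\<close>

lemma derivatives_along_segment:
  assumes X: "X \<subseteq> Rn d" "convex X" and D: "derivatives d X n F DF" and i: "i < n"
    and wy: "w \<in> X" "y \<in> X" and t: "t \<in> {0..1}"
  shows "((\<lambda>t. DF i (w + t *\<^sub>R (y - w)) (replicate i (y - w))) has_vector_derivative
    DF (Suc i) (w + t *\<^sub>R (y - w)) (replicate (Suc i) (y - w))) (at t within {0..1})"
proof -
  define h where "h = y - w"
  have h: "h \<in> Rn d" using X wy by (auto simp: h_def intro!: Rn_closed)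
  have seg: "w + t *\<^sub>R h \<in> X" if "t \<in> {0..1}" for t
    unfolding h_def by (rule convex_segmentD[OF X(2) wy that])
  have tup: "replicate i h \<in> tuples d i" using h by (simp add: tuples_def set_replicate_conv_if)
  have "\<exists>f'. ((\<lambda>y. DF i y (replicate i h)) has_derivative f') (at (w + t *\<^sub>R h) within X) \<and>
      (\<forall>u\<in>Rn d. f' u = DF (Suc i) (w + t *\<^sub>R h) (u # replicate i h))"
    using D[unfolded derivatives_def, THEN conjunct2, THEN conjunct2, rule_format, OF i seg[OF t] tup] .
  then obtain f' where f': "((\<lambda>y. DF i y (replicate i h)) has_derivative f') (at (w + t *\<^sub>R h) within X)"
      "\<forall>u\<in>Rn d. f' u = DF (Suc i) (w + t *\<^sub>R h) (u # replicate i h)"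
    by (elim exE conjE)
  have "((\<lambda>t. w + t *\<^sub>R h) has_derivative (\<lambda>t. t *\<^sub>R h)) (at t within {0..1})"
    by (auto intro!: derivative_eq_intros)
  moreover have "((\<lambda>y. DF i y (replicate i h)) has_derivative f')
      (at (w + t *\<^sub>R h) within (\<lambda>t. w + t *\<^sub>R h) ` {0..1})"
    by (rule has_derivative_subset[OF f'(1)]) (use seg in \<open>simp add: image_subset_iff\<close>)
  ultimately have "((\<lambda>t. DF i (w + t *\<^sub>R h) (replicate i h)) has_derivative (\<lambda>t. f' (t *\<^sub>R h)))
      (at t within {0..1})"
    by (rule has_derivative_in_compose)
  moreover have "f' (c *\<^sub>R h) = c *\<^sub>R DF (Suc i) (w + t *\<^sub>R h) (replicate (Suc i) h)" for c
    using linear_scale[OF has_derivative_linear[OF f'(1)], of c h] f'(2)[rule_format, OF h]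
    by (simp only: replicate_Suc)
  ultimately show ?thesis by (simp only: has_vector_derivative_def h_def)
qed

lemma taylor_error:
  assumes X: "X \<subseteq> Rn d" "convex X" and D: "derivatives d X n F DF"
    and Lip: "\<forall>y\<in>X. \<forall>z\<in>X. opnorm d n (\<lambda>hs. DF n y hs - DF n z hs) \<le> L * norm (y - z)"
    and wy: "w \<in> X" "y \<in> X"
  shows "norm (F y - (\<Sum>i\<le>n. (1 / fact i) *\<^sub>R DF i w (replicate i (y - w))))
    \<le> L * norm (y - w) ^ Suc n / fact (Suc n)"
proof -
  define h where "h = y - w"
  have h: "h \<in> Rn d" using X wy by (auto simp: h_def intro!: Rn_closed)
  define f where "f = (\<lambda>i t. DF i (w + t *\<^sub>R h) (replicate i h))"
  have top: "norm (f n t - f n 0) \<le> L * norm h ^ Suc n * t" if t: "t \<in> {0..1}" for t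
  proof -
    have seg: "w + t *\<^sub>R h \<in> X"
      unfolding h_def by (rule convex_segmentD[OF X(2) wy t])
    have "multilinear d n (\<lambda>hs. DF n (w + t *\<^sub>R h) hs - DF n w hs)"
      using D seg wy by (intro multilinear_diff) (auto simp: derivatives_def)
    from norm_diagonal_le_opnorm[OF this h]
    have "norm (f n t - f n 0) \<le> opnorm d n (\<lambda>hs. DF n (w + t *\<^sub>R h) hs - DF n w hs) * norm h ^ n"
      by (simp add: f_def)
    also have "\<dots> \<le> (L * norm ((w + t *\<^sub>R h) - w)) * norm h ^ n"
      by (rule mult_right_mono[OF Lip[rule_format, OF seg wy(1)]]) simp
    also have "\<dots> = L * norm h ^ Suc n * t" using t by simp
    finally show ?thesis .
  qed
  have step: "(f i has_vector_derivative f (Suc i) t) (at t within {0..1})"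
    if "i < n" "t \<in> {0..1}" for i t
    unfolding f_def h_def by (rule derivatives_along_segment[OF X D that(1) wy that(2)])
  have "norm (f 0 1 - (\<Sum>i\<le>n. (1 ^ i / fact i) *\<^sub>R f i 0))
      \<le> L * norm h ^ Suc n * 1 ^ Suc n / fact (Suc n)"
    by (rule taylor_Lipschitz[OF step top]) auto
  moreover have "f 0 1 = F y"
  proof -
    have "f 0 1 = DF 0 y []" by (simp add: f_def h_def)
    also have "\<dots> = F y" using D wy unfolding derivatives_def by blast
    finally show ?thesis .
  qed
  moreover have "(\<Sum>i\<le>n. (1 ^ i / fact i) *\<^sub>R f i 0)
      = (\<Sum>i\<le>n. (1 / fact i) *\<^sub>R DF i w (replicate i (y - w)))"
    by (simp add: f_def h_def)
  ultimately show ?thesis by (simp only: h_def power_one mult_1_right)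
qed

section \<open>The inexact model of the operator\<close>

text \<open>The relative error of the model at distance \<open>r\<close>: \<open>model_error p \<delta> L r * r\<close> bounds the distance between
  \<open>F\<close> and \<^const>\<open>Psi\<close>. The scheme is built around this one quantity: it is also the factor of
  \<open>\<lambda>\<close> in the step size rule, the tolerance of the subproblem divided by \<open>r\<^sup>2\<close>, and, up to the factor
  \<open>5 p\<close>, the strength of the regularisation in \<^const>\<open>Omega\<close>.\<close>

definition model_error :: "nat \<Rightarrow> (nat \<Rightarrow> real) \<Rightarrow> real \<Rightarrow> real \<Rightarrow> real" where
  "model_error p \<delta> L r = L / fact p * r ^ (p - 1) + (\<Sum>i=1..p-1. \<delta> i / fact i * r ^ (i - 1))"

lemma model_error_mult:
  "model_error p \<delta> L r * r ^ k
    = L / fact p * r ^ (p - 1 + k) + (\<Sum>i=1..p-1. \<delta> i / fact i * r ^ (i - 1 + k))"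
proof -
  have "(\<Sum>i=1..p-1. \<delta> i / fact i * r ^ (i - 1)) * r ^ k
      = (\<Sum>i=1..p-1. \<delta> i / fact i * r ^ (i - 1 + k))"
    by (simp only: sum_distrib_right power_add mult.assoc)
  then show ?thesis
    by (simp only: model_error_def distrib_right power_add mult.assoc)
qed

lemma model_error_nonneg:
  "L \<ge> 0 \<Longrightarrow> \<forall>i\<in>{1..p-1}. \<delta> i \<ge> 0 \<Longrightarrow> r \<ge> 0 \<Longrightarrow> model_error p \<delta> L r \<ge> 0"
  unfolding model_error_def by (intro add_nonneg_nonneg sum_nonneg mult_nonneg_nonneg) auto

text \<open>Since \<open>5 L / (p - 1)! = 5 p L / p!\<close>, the choice \<open>\<eta> i = 5 p\<close> gives all the regularisation
  terms the same factor.\<close>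

lemma Omega_eq_Psi:
  assumes "p \<ge> 2"
  shows "Omega p F G (\<lambda>i. 5 * real p) \<delta> L w y
    = Psi p F G w y + (5 * real p * model_error p \<delta> L (norm (y - w))) *\<^sub>R (y - w)"
proof -
  have "fact p = real p * fact (p - 1)"
    using assms by (simp add: fact_reduce)
  then have "5 * L / fact (p - 1) = 5 * real p * (L / fact p)"
    using assms by (simp add: field_simps)
  then have "5 * real p * model_error p \<delta> L (norm (y - w))
      = (\<Sum>i=1..p-1. 5 * real p * \<delta> i / fact i * norm (y - w) ^ (i - 1))
        + 5 * L / fact (p - 1) * norm (y - w) ^ (p - 1)"
    by (simp add: model_error_def distrib_left sum_distrib_left mult.assoc)
  then show ?thesis
    by (simp add: Omega_def scaleR_add_left scaleR_sum_left add.assoc)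
qed

text \<open>The hypothesis bounds the linear map left after inserting \<open>i - 1\<close> copies of \<open>h\<close>; applying that
  map to \<open>h\<close> once more gives the diagonal value.\<close>

lemma inexact_derivative_error:
  assumes M: "multilinear d i A" and i: "i \<ge> 1" and h: "h \<in> Rn d"
    and bound: "opnorm d 1 (insert_pow A (i - 1) h) \<le> \<delta> * norm h ^ (i - 1)"
  shows "norm (A (replicate i h)) \<le> \<delta> * norm h ^ i"
proof -
  have "multilinear d 1 (insert_pow A (i - 1) h)"
    using M i h by (intro multilinear_insert_pow) auto
  from norm_diagonal_le_opnorm[OF this h]
  have "norm (A (replicate (i - 1) h @ [h])) \<le> opnorm d 1 (insert_pow A (i - 1) h) * norm h"
    by (simp add: insert_pow_def)
  also have "\<dots> \<le> \<delta> * norm h ^ (i - 1) * norm h"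
    by (intro mult_right_mono bound) auto
  also have "\<dots> = \<delta> * norm h ^ i" using i by (cases i) auto
  also have "replicate (i - 1) h @ [h] = replicate i h"
    using i by (cases i) (auto simp: replicate_append_same)
  finally show ?thesis .
qed

text \<open>The error of the model splits into the Taylor remainder of the exact expansion and the
  errors of the derivatives \<open>G i\<close>, one for each summand of \<^const>\<open>model_error\<close>.\<close>

lemma Psi_error:
  assumes p: "p \<ge> 2" and X: "X \<subseteq> Rn d" "convex X" and D: "derivatives d X (p - 1) F DF"
    and Lip: "\<forall>y\<in>X. \<forall>z\<in>X.
      opnorm d (p - 1) (\<lambda>hs. DF (p - 1) y hs - DF (p - 1) z hs) \<le> L * norm (y - z)"
    and G: "\<forall>i\<in>{1..p-1}. \<forall>w\<in>X. multilinear d i (G i w)"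
    and GD: "\<forall>i\<in>{1..p-1}. \<forall>y\<in>X. \<forall>w\<in>X.
      opnorm d 1 (insert_pow (\<lambda>hs. DF i w hs - G i w hs) (i - 1) (y - w))
        \<le> \<delta> i * norm (y - w) ^ (i - 1)"
    and wy: "w \<in> X" "y \<in> X"
  shows "norm (F y - Psi p F G w y)
    \<le> model_error p \<delta> L (norm (y - w)) * norm (y - w)"
proof -
  let ?r = "norm (y - w)"
  let ?n = "p - 1"
  define E where "E = (\<lambda>i. DF i w (replicate i (y - w)) - G i w (replicate i (y - w)))"
  have split: "(\<Sum>i\<le>?n. (1 / fact i) *\<^sub>R DF i w (replicate i (y - w)))
      = F w + (\<Sum>i=1..?n. (1 / fact i) *\<^sub>R DF i w (replicate i (y - w)))"
  proof -
    have "{..?n} = insert 0 {1..?n}" by auto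
    then show ?thesis using D wy by (simp add: derivatives_def)
  qed
  have "F y - Psi p F G w y
      = (F y - (\<Sum>i\<le>?n. (1 / fact i) *\<^sub>R DF i w (replicate i (y - w))))
        + (\<Sum>i=1..?n. (1 / fact i) *\<^sub>R E i)"
    unfolding split Psi_def E_def by (simp add: scaleR_diff_right sum_subtractf)
  also have "norm \<dots> \<le> L * ?r ^ Suc ?n / fact (Suc ?n) + (\<Sum>i=1..?n. \<delta> i / fact i * ?r ^ i)"
  proof (rule norm_triangle_mono[OF taylor_error[OF X D Lip wy] sum_norm_le])
    fix i assume i: "i \<in> {1..?n}"
    have "norm (E i) \<le> \<delta> i * ?r ^ i"
      unfolding E_def
    proof (rule inexact_derivative_error)
      show "multilinear d i (\<lambda>hs. DF i w hs - G i w hs)"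
        using D G i wy by (intro multilinear_diff) (auto simp: derivatives_def)
    qed (use GD i wy X in \<open>auto intro!: Rn_closed\<close>)
    then have "norm (E i) / fact i \<le> \<delta> i * ?r ^ i / fact i"
      by (intro divide_right_mono) auto
    then show "norm ((1 / fact i) *\<^sub>R E i) \<le> \<delta> i / fact i * ?r ^ i" by simp
  qed
  also have "\<dots> = model_error p \<delta> L ?r * ?r ^ 1"
    unfolding model_error_mult using p by (auto intro!: sum.cong)
  finally show ?thesis by simp
qed

section \<open>Dual extrapolation\<close>

text \<open>The objective of the \<open>v\<close>-update is strongly concave with modulus \<open>1\<close>, so it drops
  quadratically away from its maximiser.\<close>

lemma is_arg_max_three_point:
  fixes X :: "'a::real_inner set"
  assumes X: "convex X" "closed X"
    and v: "is_arg_max (\<lambda>w. inner s (w - x0) - 1/2 * (norm (w - x0))\<^sup>2) (\<lambda>w. w \<in> X) v"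
    and w: "w \<in> X"
  shows "inner s (w - x0) - 1/2 * (norm (w - x0))\<^sup>2
    \<le> inner s (v - x0) - 1/2 * (norm (v - x0))\<^sup>2 - 1/2 * (norm (w - v))\<^sup>2"
proof -
  \<comment> \<open>Completing the square: \<open>v\<close> is the projection of \<open>x0 + s\<close> onto \<open>X\<close>.\<close>
  have square: "inner s (z - x0) - 1/2 * (norm (z - x0))\<^sup>2
      = 1/2 * (norm s)\<^sup>2 - 1/2 * (dist (x0 + s) z)\<^sup>2" for z
    by (simp add: dist_norm power2_norm_eq_inner algebra_simps inner_commute)
  have "\<forall>z\<in>X. dist (x0 + s) v \<le> dist (x0 + s) z"
  proof
    fix z assume "z \<in> X"
    then have "inner s (z - x0) - 1/2 * (norm (z - x0))\<^sup>2
        \<le> inner s (v - x0) - 1/2 * (norm (v - x0))\<^sup>2"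
      using v unfolding is_arg_max_linorder by blast
    then have "(dist (x0 + s) v)\<^sup>2 \<le> (dist (x0 + s) z)\<^sup>2"
      unfolding square by linarith
    then show "dist (x0 + s) v \<le> dist (x0 + s) z" by (rule power2_le_imp_le) simp
  qed
  then have "inner (x0 + s - v) (w - v) \<le> 0"
    using X v w by (intro any_closest_point_dot[of X]) (auto simp: is_arg_max_linorder)
  then show ?thesis by (simp add: power2_norm_eq_inner algebra_simps inner_commute)
qed

text \<open>The progress made by one step. Here \<open>f\<close> is the operator at \<open>x\<close>, \<open>\<psi>\<close> its model, and \<open>e\<close> the
  relative error of the model. The regularisation contributes
  \<open>\<langle>x - v, x - w\<rangle> = (\<parallel>x - v\<parallel>\<^sup>2 + \<parallel>x - w\<parallel>\<^sup>2 - \<parallel>v - w\<parallel>\<^sup>2) / 2\<close> with the factor \<open>- 5 p \<lambda> e\<close>: its first two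
  terms absorb the model error, and the upper bound on \<open>\<lambda> e\<close> keeps the coefficient of
  \<open>\<parallel>v - w\<parallel>\<^sup>2\<close> below \<open>1/2\<close>. The lower bound on \<open>\<lambda> e\<close> makes the gain in \<open>\<parallel>x - v\<parallel>\<^sup>2\<close> at least
  \<open>(5 p - 3) / (8 (5 p - 2)) \<ge> 1/16\<close>.\<close>

lemma one_step_progress:
  fixes f \<psi> x v w :: "'a::real_inner" and p e lam :: real
  assumes p: "p \<ge> 2" and e: "e \<ge> 0" and lam: "lam \<ge> 0"
    and model: "norm (f - \<psi>) \<le> e * norm (x - v)"
    and solved: "inner (\<psi> + (5 * p * e) *\<^sub>R (x - v)) (x - w) \<le> e * (norm (x - v))\<^sup>2"
    and lower: "1 / (4 * (5 * p - 2)) \<le> lam * e" and upper: "lam * e \<le> 1 / (2 * (5 * p + 1))"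
  shows "lam * inner f (x - w) + (norm (x - v))\<^sup>2 / 16 \<le> (norm (w - v))\<^sup>2 / 2"
proof -
  define r q n a where "r = norm (x - v)" and "q = norm (x - w)" and "n = norm (w - v)"
    and "a = lam * e"
  have a: "a \<ge> 0" using e lam by (simp add: a_def)
  have cosine: "inner (x - v) (x - w) = (r\<^sup>2 + q\<^sup>2 - n\<^sup>2) / 2"
    by (simp add: r_def q_def n_def power2_norm_eq_inner algebra_simps inner_commute)
  have "inner (f - \<psi>) (x - w) \<le> e * r * q"
    using norm_cauchy_schwarz[of "f - \<psi>" "x - w"] mult_right_mono[OF model, of q]
    by (simp add: r_def q_def)
  also have "\<dots> \<le> e * ((r\<^sup>2 + q\<^sup>2) / 2)"
    using mult_left_mono[OF sum_squares_bound[of r q] e] by (simp add: algebra_simps)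
  finally have "inner f (x - w) \<le> e * ((r\<^sup>2 + q\<^sup>2) / 2) + e * r\<^sup>2 - 5 * p * e * ((r\<^sup>2 + q\<^sup>2 - n\<^sup>2) / 2)"
    using solved unfolding inner_diff_left[of f] inner_add_left inner_scaleR_left cosine r_def[symmetric]
    by linarith
  then have "lam * inner f (x - w)
      \<le> lam * (e * ((r\<^sup>2 + q\<^sup>2) / 2) + e * r\<^sup>2 - 5 * p * e * ((r\<^sup>2 + q\<^sup>2 - n\<^sup>2) / 2))"
    using lam by (rule mult_left_mono)
  also have "\<dots> = 5 * p * a / 2 * n\<^sup>2 - a * (5 * p - 1) / 2 * q\<^sup>2 - a * (5 * p - 3) / 2 * r\<^sup>2"
    by (simp add: a_def field_simps)
  also have "\<dots> \<le> 1/2 * n\<^sup>2 - 0 - 1/16 * r\<^sup>2"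
  proof (intro diff_mono mult_right_mono)
    have "5 * p * a \<le> 5 * p * (1 / (2 * (5 * p + 1)))"
      using upper p by (intro mult_left_mono) (auto simp: a_def)
    also have "\<dots> \<le> 1" using p by (simp add: divide_simps)
    finally show "5 * p * a / 2 \<le> 1/2" by linarith
    have "1/16 \<le> 1 / (4 * (5 * p - 2)) * ((5 * p - 3) / 2)" using p by (simp add: divide_simps)
    also have "\<dots> \<le> a * ((5 * p - 3) / 2)"
      using lower p by (intro mult_right_mono) (auto simp: a_def)
    finally show "1/16 \<le> a * (5 * p - 3) / 2" by simp
  qed (use a p in auto)
  finally show ?thesis by (simp add: r_def n_def)
qed

text \<open>A potential argument. The objective of the \<open>v\<close>-update at any point of \<open>X\<close>, plus
  \<open>\<Sum> \<lambda>\<^sub>k \<langle>f\<^sub>k, x\<^sub>k - x\<^sub>0\<rangle> + g\<^sub>k\<close>, stays nonpositive: the loss \<open>\<parallel>w - v\<parallel>\<^sup>2 / 2\<close> of one step is paid by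
  the strong concavity of that objective. Here \<open>g\<close> is the gain of a step, later \<open>\<parallel>x - v\<parallel>\<^sup>2 / 16\<close>.\<close>

lemma dual_extrapolation_regret:
  fixes X :: "'a::real_inner set"
  assumes X: "convex X" "closed X" and s0: "s 0 = 0"
    and v: "\<And>k. k < T \<Longrightarrow> is_arg_max (\<lambda>w. inner (s k) (w - x0) - 1/2 * (norm (w - x0))\<^sup>2)
      (\<lambda>w. w \<in> X) (v (Suc k))"
    and s: "\<And>k. k < T \<Longrightarrow> s (Suc k) = s k - lam (Suc k) *\<^sub>R f (Suc k)"
    and progress: "\<And>k w. k < T \<Longrightarrow> w \<in> X \<Longrightarrow>
      lam (Suc k) * inner (f (Suc k)) (x (Suc k) - w) + g (Suc k) \<le> (norm (w - v (Suc k)))\<^sup>2 / 2"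
    and w: "w \<in> X"
  shows "(\<Sum>k=1..T. lam k * inner (f k) (x k - w) + g k) \<le> (norm (w - x0))\<^sup>2 / 2"
proof -
  define A where "A = (\<lambda>m. \<Sum>k=1..m. lam k * inner (f k) (x k - x0) + g k)"
  have potential: "inner (s m) (z - x0) - 1/2 * (norm (z - x0))\<^sup>2 + A m \<le> 0"
    if "m \<le> T" "z \<in> X" for m z
    using that
  proof (induction m arbitrary: z)
    case 0
    then show ?case by (simp add: s0 A_def)
  next
    case (Suc m)
    then have m: "m < T" by simp
    then have vX: "v (Suc m) \<in> X" using v by (auto simp: is_arg_max_def)
    show ?case
      using is_arg_max_three_point[OF X v[OF m] Suc.prems(2)] Suc.IH[OF _ vX] m
        progress[OF m Suc.prems(2)]
      by (simp add: A_def s inner_diff_left inner_diff_right algebra_simps)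
  qed
  have sm: "s m = - (\<Sum>k=1..m. lam k *\<^sub>R f k)" if "m \<le> T" for m
    using that by (induction m) (auto simp: s0 s)
  have "(\<Sum>k=1..T. lam k * inner (f k) (x k - w) + g k) = A T + inner (s T) (w - x0)"
    by (simp add: A_def sm inner_sum_left sum.distrib inner_diff_right right_diff_distrib
      sum_subtractf)
  then show ?thesis using potential[of T w] w by simp
qed

text \<open>An approximate solution of the regularised model is an approximate solution of the
  variational inequality: the model error and the regularisation are each of order \<open>e r\<close>.\<close>

lemma approximate_solution_gap:
  fixes f \<psi> x v y :: "'a::real_inner" and p e D :: real
  assumes p: "p \<ge> 0" and e: "e \<ge> 0"
    and model: "norm (f - \<psi>) \<le> e * norm (x - v)"
    and solved: "inner (\<psi> + (5 * p * e) *\<^sub>R (x - v)) (x - y) \<le> e * (norm (x - v))\<^sup>2"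
    and D: "norm (x - v) \<le> D" "norm (x - y) \<le> D"
  shows "inner f (x - y) \<le> (5 * p + 2) * (e * norm (x - v)) * D"
proof -
  define r where "r = norm (x - v)"
  have r: "0 \<le> r" "r \<le> D" using D by (auto simp: r_def)
  have "inner (f - \<psi>) (x - y) \<le> norm (f - \<psi>) * norm (x - y)"
    by (rule norm_cauchy_schwarz)
  also have "\<dots> \<le> (e * r) * D"
    using model D e r by (intro mult_mono) (auto simp: r_def)
  finally have 1: "inner (f - \<psi>) (x - y) \<le> e * r * D" .
  have "- inner (x - v) (x - y) \<le> r * norm (x - y)"
    using norm_cauchy_schwarz[of "- (x - v)" "x - y"]
    by (simp add: r_def norm_minus_commute flip: inner_minus_left)
  also have "\<dots> \<le> r * D" using D r by (intro mult_left_mono) auto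
  finally have "5 * p * e * - inner (x - v) (x - y) \<le> 5 * p * e * (r * D)"
    using p e by (intro mult_left_mono) auto
  moreover have "e * r\<^sup>2 \<le> e * r * D"
    using e r by (simp add: power2_eq_square mult.assoc mult_left_mono)
  ultimately have "inner f (x - y) \<le> e * r * D + e * r * D + 5 * p * e * (r * D)"
    using 1 solved unfolding inner_diff_left[of f] inner_add_left inner_scaleR_left r_def[symmetric]
    by linarith
  then show ?thesis by (simp add: r_def algebra_simps)
qed

section \<open>The rate of convergence\<close>

lemma power_le_rate:
  fixes r D :: real
  assumes r: "0 \<le> r" "r \<le> 3 * D / sqrt (real T)" and D: "D \<ge> 0" and T: "T \<ge> 1" and i: "i \<le> p"
  shows "r ^ i * D \<le> 3 ^ p * (D ^ (i + 1) / real T powr (real i / 2))"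
proof -
  have "r ^ i \<le> (3 * D / sqrt (real T)) ^ i" using r by (rule power_mono[rotated])
  also have "\<dots> = 3 ^ i * (D ^ i / sqrt (real T) ^ i)"
    by (simp add: power_mult_distrib power_divide)
  also have "sqrt (real T) ^ i = real T powr (real i / 2)"
    using T by (simp add: powr_power flip: powr_half_sqrt)
  also have "3 ^ i * (D ^ i / real T powr (real i / 2)) \<le> 3 ^ p * (D ^ i / real T powr (real i / 2))"
    using i D by (intro mult_right_mono power_increasing) auto
  finally have "r ^ i * D \<le> 3 ^ p * (D ^ i / real T powr (real i / 2)) * D"
    using D by (rule mult_right_mono)
  then show ?thesis by (simp add: mult_ac)
qed

text \<open>By the Minty condition the linearised gaps at the solution are
  nonnegative, so the regret bound leaves \<open>\<Sum> \<parallel>x k - v k\<parallel>\<^sup>2 / 16 \<le> D\<^sup>2 / 2\<close>, and the shortest step is at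
  most \<open>3 D / \<surd>T\<close>.\<close>

lemma VIHI_gap:
  assumes p: "p \<ge> 2" and X: "X \<subseteq> Rn d" "closed X" "bounded X" "convex X"
    and minty: "minty X F" and DF: "derivatives d X (p - 1) F DF"
    and Lip: "\<forall>y\<in>X. \<forall>z\<in>X.
      opnorm d (p - 1) (\<lambda>hs. DF (p - 1) y hs - DF (p - 1) z hs) \<le> L * norm (y - z)"
    and \<delta>: "\<forall>i\<in>{1..p-1}. \<delta> i \<ge> 0"
    and G: "\<forall>i\<in>{1..p-1}. \<forall>w\<in>X. multilinear d i (G i w)"
    and GD: "\<forall>i\<in>{1..p-1}. \<forall>y\<in>X. \<forall>w\<in>X.
      opnorm d 1 (insert_pow (\<lambda>hs. DF i w hs - G i w hs) (i - 1) (y - w))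
        \<le> \<delta> i * norm (y - w) ^ (i - 1)"
    and T: "T \<ge> 1"
    and run: "VIHI p X F G (\<lambda>i. 5 * real p) \<delta> L T x v s lam"
    and kT: "is_arg_min (\<lambda>k. norm (x k - v k)) (\<lambda>k. k \<in> {1..T}) kT"
    and L: "L \<ge> 0" and y: "y \<in> X"
  shows "inner (F (x kT)) (x kT - y)
    \<le> (5 * real p + 2) * 3 ^ p * (L * diameter X ^ (p + 1) / real T powr (real p / 2)
      + (\<Sum>i=1..p-1. \<delta> i * diameter X ^ (i + 1) / real T powr (real i / 2)))"
proof -
  define D where "D = diameter X"
  define e where "e = (\<lambda>k. model_error p \<delta> L (norm (x k - v k)))"
  define \<psi> where "\<psi> = (\<lambda>k. Psi p F G (v k) (x k))"
  have D: "norm (a - b) \<le> D" if "a \<in> X" "b \<in> X" for a b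
    using diameter_bounded_bound[OF X(3) that] by (simp add: dist_norm D_def)
  have D0: "D \<ge> 0" using X(3) by (simp add: D_def diameter_ge_0)
  have e: "e k \<ge> 0" for k
    unfolding e_def using L \<delta> by (intro model_error_nonneg) auto
  have x0: "x 0 \<in> X" and s0: "s 0 = 0" using run by (auto simp: VIHI_def)
  have v_arg: "is_arg_max (\<lambda>w. inner (s k) (w - x 0) - 1/2 * (norm (w - x 0))\<^sup>2) (\<lambda>w. w \<in> X) (v (Suc k))"
    if "k < T" for k using run that by (simp add: VIHI_def)
  have vX: "v (Suc k) \<in> X" if "k < T" for k
    using v_arg[OF that] by (simp add: is_arg_max_def)
  have xX: "x (Suc k) \<in> X" if "k < T" for k
    using run that by (simp add: VIHI_def)
  have step_size: "1 / (4 * (5 * real p - 2)) \<le> lam (Suc k) * e (Suc k)"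
      "lam (Suc k) * e (Suc k) \<le> 1 / (2 * (5 * real p + 1))" if "k < T" for k
    using run that by (simp_all add: VIHI_def e_def model_error_def)
  have s_step: "s (Suc k) = s k - lam (Suc k) *\<^sub>R F (x (Suc k))" if "k < T" for k
    using run that by (simp add: VIHI_def)
  \<comment> \<open>The lower bound of the step size rule forces the sign of the step.\<close>
  have lam: "lam (Suc k) \<ge> 0" if "k < T" for k
  proof -
    have "0 < 1 / (4 * (5 * real p - 2))" using p by simp
    then have "0 < lam (Suc k) * e (Suc k)" using step_size(1)[OF that] by linarith
    then show ?thesis using e[of "Suc k"] by (simp add: zero_less_mult_iff)
  qed
  have model: "norm (F (x (Suc k)) - \<psi> (Suc k)) \<le> e (Suc k) * norm (x (Suc k) - v (Suc k))"
    if "k < T" for k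
    unfolding \<psi>_def e_def using Psi_error[OF p X(1,4) DF Lip G GD vX[OF that] xX[OF that]] .
  have solved: "inner (\<psi> (Suc k) + (5 * real p * e (Suc k)) *\<^sub>R (x (Suc k) - v (Suc k))) (x (Suc k) - w)
      \<le> e (Suc k) * (norm (x (Suc k) - v (Suc k)))\<^sup>2" if k: "k < T" and w: "w \<in> X" for k w
  proof -
    let ?O = "Omega p F G (\<lambda>i. 5 * real p) \<delta> L (v (Suc k)) (x (Suc k))"
    let ?r = "norm (x (Suc k) - v (Suc k))"
    \<comment> \<open>\<open>X\<close> is bounded, so the supremum in the stopping rule dominates each of its values.\<close>
    have "bdd_above ((\<lambda>w. inner ?O (x (Suc k) - w)) ` X)"
    proof (rule bdd_aboveI2)
      fix w assume "w \<in> X"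
      have "inner ?O (x (Suc k) - w) \<le> norm ?O * norm (x (Suc k) - w)"
        by (rule norm_cauchy_schwarz)
      also have "\<dots> \<le> norm ?O * D" using D[OF xX[OF k] \<open>w \<in> X\<close>] by (rule mult_left_mono) simp
      finally show "inner ?O (x (Suc k) - w) \<le> norm ?O * D" .
    qed
    from cSUP_upper[OF w this]
    have "inner ?O (x (Suc k) - w) \<le> (SUP w\<in>X. inner ?O (x (Suc k) - w))" .
    also have "\<dots> \<le> L / fact p * ?r ^ (p + 1) + (\<Sum>i=1..p-1. \<delta> i / fact i * ?r ^ (i + 1))"
      using run k by (simp add: VIHI_def)
    also have "\<dots> = e (Suc k) * ?r\<^sup>2"
      unfolding e_def model_error_mult
      using p by (intro arg_cong2[of _ _ _ _ "(+)"] sum.cong) (auto simp: Suc_diff_le numeral_2_eq_2)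
    finally show ?thesis unfolding Omega_eq_Psi[OF p] \<psi>_def e_def .
  qed
  obtain z where z: "z \<in> X" "\<And>w. w \<in> X \<Longrightarrow> inner (F w) (w - z) \<ge> 0"
    using minty by (auto simp: minty_def)
  have progress: "lam (Suc k) * inner (F (x (Suc k))) (x (Suc k) - w)
      + (norm (x (Suc k) - v (Suc k)))\<^sup>2 / 16 \<le> (norm (w - v (Suc k)))\<^sup>2 / 2"
    if "k < T" "w \<in> X" for k w
    using p e lam[OF that(1)] model[OF that(1)] solved[OF that] step_size[OF that(1)]
    by (intro one_step_progress[where p = "real p"]) auto
  define r where "r = norm (x kT - v kT)"
  obtain k where k: "k < T" "kT = Suc k"
    using kT by (cases kT) (auto simp: is_arg_min_def)
  have "real T * (r\<^sup>2 / 16) = (\<Sum>k=1..T. r\<^sup>2 / 16)" by simp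
  also have "\<dots> \<le> (\<Sum>k=1..T. lam k * inner (F (x k)) (x k - z) + (norm (x k - v k))\<^sup>2 / 16)"
  proof (rule sum_mono)
    fix j assume j: "j \<in> {1..T}"
    then obtain i where i: "i < T" "j = Suc i" by (cases j) auto
    have "r \<le> norm (x j - v j)" using kT j by (simp add: is_arg_min_linorder r_def)
    then have "r\<^sup>2 \<le> (norm (x j - v j))\<^sup>2" by (rule power_mono) (simp add: r_def)
    moreover have "0 \<le> lam j * inner (F (x j)) (x j - z)"
      using lam[OF i(1)] z(2)[OF xX[OF i(1)]] i(2) by simp
    ultimately show "r\<^sup>2 / 16 \<le> lam j * inner (F (x j)) (x j - z) + (norm (x j - v j))\<^sup>2 / 16"
      by linarith
  qed
  also have "\<dots> \<le> (norm (z - x 0))\<^sup>2 / 2"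
    by (rule dual_extrapolation_regret[of X s T "x 0" v lam "\<lambda>k. F (x k)"])
      (use X s0 v_arg s_step progress z(1) in auto)
  also have "\<dots> \<le> D\<^sup>2 / 2"
    using D[OF z(1) x0] by (simp add: power_mono)
  finally have "real T * r\<^sup>2 \<le> 8 * D\<^sup>2" by simp
  \<comment> \<open>Rounding \<open>\<surd>8\<close> up to \<open>3\<close> gives the \<open>3 ^ p\<close> in the constant.\<close>
  also have "\<dots> \<le> (3 * D)\<^sup>2" by (simp add: power_mult_distrib)
  finally have "real T * r\<^sup>2 \<le> (3 * D)\<^sup>2" .
  then have "r\<^sup>2 \<le> (3 * D / sqrt (real T))\<^sup>2"
    using T by (simp add: power_divide pos_le_divide_eq mult.commute)
  then have r: "r \<le> 3 * D / sqrt (real T)"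
    by (rule power2_le_imp_le) (use D0 in simp)
  have r0: "r \<ge> 0" by (simp add: r_def)
  let ?R = "\<lambda>i. 3 ^ p * (D ^ (i + 1) / real T powr (real i / 2))"
  have rate: "c / fact i * r ^ i * D \<le> c * ?R i" if "c \<ge> 0" "i \<le> p" for c i
  proof -
    have "c / fact i * (r ^ i * D) \<le> c * ?R i"
      using that D0 r0 by (intro mult_mono power_le_rate[OF r0 r D0 T])
        (auto simp: divide_le_eq mult_le_cancel_left1 fact_ge_1)
    then show ?thesis by (simp add: mult.assoc)
  qed
  have "inner (F (x kT)) (x kT - y) \<le> (5 * real p + 2) * (e kT * r) * D"
    unfolding r_def k(2)
    by (rule approximate_solution_gap[OF _ e model[OF k(1)] solved[OF k(1) y]])
      (use D xX[OF k(1)] vX[OF k(1)] y in auto)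
  also have "\<dots> = (5 * real p + 2) * ((e kT * r) * D)" by simp
  also have "\<dots> \<le> (5 * real p + 2) * (L * ?R p + (\<Sum>i=1..p-1. \<delta> i * ?R i))"
  proof (rule mult_left_mono)
    have "e kT * r = L / fact p * r ^ p + (\<Sum>i=1..p-1. \<delta> i / fact i * r ^ i)"
    proof -
      have "e kT * r = model_error p \<delta> L r * r ^ 1" by (simp add: e_def r_def)
      also have "\<dots> = L / fact p * r ^ p + (\<Sum>i=1..p-1. \<delta> i / fact i * r ^ i)"
        unfolding model_error_mult using p
        by (intro arg_cong2[of _ _ _ _ "(+)"] sum.cong) auto
      finally show ?thesis .
    qed
    then have "(e kT * r) * D = L / fact p * r ^ p * D + (\<Sum>i=1..p-1. \<delta> i / fact i * r ^ i * D)"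
      by (simp only: distrib_right sum_distrib_right)
    also have "\<dots> \<le> L * ?R p + (\<Sum>i=1..p-1. \<delta> i * ?R i)"
      using L \<delta> by (intro add_mono sum_mono rate) auto
    finally show "(e kT * r) * D \<le> L * ?R p + (\<Sum>i=1..p-1. \<delta> i * ?R i)" .
  qed simp
  also have "L * ?R p + (\<Sum>i=1..p-1. \<delta> i * ?R i)
      = 3 ^ p * (L * D ^ (p + 1) / real T powr (real p / 2)
        + (\<Sum>i=1..p-1. \<delta> i * D ^ (i + 1) / real T powr (real i / 2)))"
    by (simp add: distrib_left sum_distrib_left mult_ac)
  finally show ?thesis by (simp only: D_def mult.assoc)
qed

text \<open>Two distinct points are required: on a singleton the Lipschitz condition holds for every
  real \<open>L\<close>.\<close>

lemma Lipschitz_constant_nonneg: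
  assumes DF: "derivatives d X n F DF"
    and Lip: "\<forall>y\<in>X. \<forall>z\<in>X. opnorm d n (\<lambda>hs. DF n y hs - DF n z hs) \<le> L * norm (y - z)"
    and yz: "y \<in> X" "z \<in> X" "y \<noteq> z"
  shows "L \<ge> 0"
proof -
  have "0 \<le> opnorm d n (\<lambda>hs. DF n y hs - DF n z hs)"
    using DF yz by (intro opnorm_nonneg multilinear_diff) (auto simp: derivatives_def)
  also have "\<dots> \<le> L * norm (y - z)" using Lip yz by blast
  finally show ?thesis using yz by (simp add: zero_le_mult_iff)
qed

theorem theorem7p3:
  fixes p :: nat
  assumes "p \<ge> 2"
  shows "\<exists>C>0. \<forall>(d::nat) (X::fseq set) (F::fseq \<Rightarrow> fseq)
      (DF::nat \<Rightarrow> fseq \<Rightarrow> fseq list \<Rightarrow> fseq) (L::real)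
      (G::nat \<Rightarrow> fseq \<Rightarrow> fseq list \<Rightarrow> fseq) (\<delta>::nat \<Rightarrow> real)
      (T::nat) (x::nat \<Rightarrow> fseq) (v::nat \<Rightarrow> fseq) (s::nat \<Rightarrow> fseq) (lam::nat \<Rightarrow> real) (kT::nat).
    X \<subseteq> Rn d \<longrightarrow> X \<noteq> {} \<longrightarrow> closed X \<longrightarrow> bounded X \<longrightarrow> convex X \<longrightarrow>
    F ` X \<subseteq> Rn d \<longrightarrow> continuous_on X F \<longrightarrow> minty X F \<longrightarrow>
    derivatives d X (p - 1) F DF \<longrightarrow>
    (\<forall>y\<in>X. \<forall>z\<in>X.
      opnorm d (p - 1) (\<lambda>hs. DF (p - 1) y hs - DF (p - 1) z hs) \<le> L * norm (y - z)) \<longrightarrow>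
    (\<forall>i\<in>{1..p-1}. \<delta> i \<ge> 0) \<longrightarrow>
    (\<forall>i\<in>{1..p-1}. \<forall>w\<in>X. multilinear d i (G i w)) \<longrightarrow>
    (\<forall>i\<in>{1..p-1}. \<forall>y\<in>X. \<forall>w\<in>X.
      opnorm d 1 (insert_pow (\<lambda>hs. DF i w hs - G i w hs) (i - 1) (y - w))
        \<le> \<delta> i * norm (y - w) ^ (i - 1)) \<longrightarrow>
    T \<ge> 1 \<longrightarrow>
    VIHI p X F G (\<lambda>i. 5 * real p) \<delta> L T x v s lam \<longrightarrow>
    is_arg_min (\<lambda>k. norm (x k - v k)) (\<lambda>k. k \<in> {1..T}) kT \<longrightarrow>
    (SUP y\<in>X. inner (F (x kT)) (x kT - y))
      \<le> C * (L * diameter X ^ (p + 1) / real T powr (real p / 2)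
             + (\<Sum>i=1..p-1. \<delta> i * diameter X ^ (i + 1) / real T powr (real i / 2)))"
proof (intro exI[of _ "(5 * real p + 2) * 3 ^ p"] conjI allI impI)
  fix d X F DF L G \<delta> T x v s lam kT
  assume X: "X \<subseteq> Rn d" "closed X" "bounded X" "convex X" and ne: "X \<noteq> {}"
    and minty: "minty X F" and DF: "derivatives d X (p - 1) F DF"
    and Lip: "\<forall>y\<in>X. \<forall>z\<in>X.
      opnorm d (p - 1) (\<lambda>hs. DF (p - 1) y hs - DF (p - 1) z hs) \<le> L * norm (y - z)"
    and rest: "\<forall>i\<in>{1..p-1}. \<delta> i \<ge> 0" "\<forall>i\<in>{1..p-1}. \<forall>w\<in>X. multilinear d i (G i w)"
      "\<forall>i\<in>{1..p-1}. \<forall>y\<in>X. \<forall>w\<in>X.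
        opnorm d 1 (insert_pow (\<lambda>hs. DF i w hs - G i w hs) (i - 1) (y - w))
          \<le> \<delta> i * norm (y - w) ^ (i - 1)"
      "T \<ge> 1" "VIHI p X F G (\<lambda>i. 5 * real p) \<delta> L T x v s lam"
    and kT: "is_arg_min (\<lambda>k. norm (x k - v k)) (\<lambda>k. k \<in> {1..T}) kT"
  let ?R = "(5 * real p + 2) * 3 ^ p * (L * diameter X ^ (p + 1) / real T powr (real p / 2)
    + (\<Sum>i=1..p-1. \<delta> i * diameter X ^ (i + 1) / real T powr (real i / 2)))"
  have xX: "x kT \<in> X"
    using kT rest(5) by (cases kT) (auto simp: is_arg_min_def VIHI_def)
  show "(SUP y\<in>X. inner (F (x kT)) (x kT - y)) \<le> ?R"
  proof (rule cSUP_least[OF ne])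
    fix y assume y: "y \<in> X"
    show "inner (F (x kT)) (x kT - y) \<le> ?R"
    proof (cases "X = {x kT}")
      case True
      \<comment> \<open>\<open>L\<close> may be negative here, but both sides of the inequality vanish.\<close>
      then have "diameter X = 0" by (metis diameter_singleton)
      then show ?thesis using True y by simp
    next
      case False
      then obtain z where "z \<in> X" "z \<noteq> x kT" using xX by blast
      then have "L \<ge> 0" using Lipschitz_constant_nonneg[OF DF Lip] xX by blast
      then show ?thesis by (rule VIHI_gap[OF assms X minty DF Lip rest kT _ y])
    qed
  qed
qed simp

end
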